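(* Let $m\in\mathbb{R}$ and let $S$ be an invariant surface in Sol, with maximal generating curve $\alpha$, whose principal curvatures satisfy $\kappa_1=m\kappa_2$. Then $S$ is a leaf of $\mathcal{F}_2$, or we have the following classification according to the value of $m$: (1) If $m=1$, the surface is an umbilical surface. (2) If $m=-1$, the surface is a minimal surface. (3) If $m>-1$ or $m<-2$, then $\alpha$ is a graph of a function $z=z(y)$, with a single minimum (if $m<-2$) or a single maximum (if $m>-1$). Moreover, $\alpha$ is asymptotic to two vertical lines. (4) If $m\in(-2,-1)$, then $\alpha$ is a graph of a function $z=z(y)$ defined on the whole of $\mathbb{R}$ and it presents a single minimum. (5) If $m=-2$, then, up to integration constants, $\alpha$ is given by the graph of $z(y)=\log(\cosh(y))$.
   Context: Sol is $\mathbb{R}^3$ with the Riemannian metric $e^{2z}dx^2+e^{-2z}dy^2+dz^2$. An orthonormal frame is $E_1=e^{-z}\partial_x$, $E_2=e^{z}\partial_y$, $E_3=\partial_z$. An invariant surface is a surface invariant under the one-parameter group of isometries $T_{1,c}(x,y,z)=(x+c,y,z)$, $c\in\mathbb{R}$. It is parametrized by $X(s,t)=(t,y(s),z(s))$, $s\in I$ (an open interval), $t\in\mathbb{R}$, where $\alpha(s)=(0,y(s),z(s))$ is the generating curve, parametrized by arc length: $y'=e^{z}\cos\theta$, $z'=\sin\theta$ for a smooth angle function $\theta=\theta(s)$. With the orientation $N=-\sin\theta\,E_2+\cos\theta\,E_3$, the principal curvatures are, in this order, $\kappa_1=\theta'+\cos\theta$ (in the direction $X_s$) and $\kappa_2=-\cos\theta$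 (in the direction $X_t$). Umbilical means $\kappa_1=\kappa_2$ everywhere; minimal means $\kappa_1+\kappa_2=0$ everywhere. The foliation $\mathcal{F}_2$ is $\{Q_t\}_{t\in\mathbb{R}}$ with $Q_t=\{(x,t,z):x,z\in\mathbb{R}\}$. The generating curve is maximal: $(y,z,\theta)$ is a smooth solution, on its maximal open interval of existence, of the ODE system given by $y'=e^z\cos\theta$, $z'=\sin\theta$ and the curvature condition. A graph $z=z(y)$ is asymptotic to the vertical line $y=y_0$ if $|z(y)|\to\infty$ as $y\to y_0$ from inside the domain. "Up to integration constants" means: up to reparametrizations $s\mapsto\pm s+s_0$ of $\alpha$ and up to the isometries of Sol $(x,y,z)\mapsto(x,y+b,z)$ and $(x,y,z)\mapsto(e^{\lambda}x,e^{-\lambda}y,z-\lambda)$. *)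

theory Defs
  imports "HOL-Analysis.Analysis"
begin

section \<open>The Riemannian manifold Sol\<close>

type_synonym pt = "real ^ 3"

definition sol_metric :: "pt \<Rightarrow> real ^ 3 ^ 3" where
  "sol_metric p = vector [vector [exp (2 * p $ 3), 0, 0],
                          vector [0, exp (- 2 * p $ 3), 0],
                          vector [0, 0, 1]]"

definition partial_deriv :: "3 \<Rightarrow> (pt \<Rightarrow> real) \<Rightarrow> pt \<Rightarrow> real" where
  "partial_deriv i f p = deriv (\<lambda>h. f (p + h *\<^sub>R axis i 1)) 0"

text \<open>\<open>christoffel p k i j\<close> is the symbol with upper index \<open>k\<close> and lower indices \<open>i\<close>, \<open>j\<close>
  of the Levi-Civita connection.\<close>

definition christoffel :: "pt \<Rightarrow> 3 \<Rightarrow> 3 \<Rightarrow> 3 \<Rightarrow> real" where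
  "christoffel p k i j =
     (1 / 2) * (\<Sum>l\<in>UNIV. matrix_inv (sol_metric p) $ k $ l *
        (partial_deriv i (\<lambda>q. sol_metric q $ j $ l) p
       + partial_deriv j (\<lambda>q. sol_metric q $ i $ l) p
       - partial_deriv l (\<lambda>q. sol_metric q $ i $ j) p))"

text \<open>Levi-Civita covariant derivative of a vector field \<open>W\<close> along the curve \<open>\<gamma>\<close>.\<close>

definition cov_deriv :: "(real \<Rightarrow> pt) \<Rightarrow> (real \<Rightarrow> real ^ 3) \<Rightarrow> real \<Rightarrow> real ^ 3" where
  "cov_deriv \<gamma> W u = vector_derivative W (at u) +
     (\<chi> k. \<Sum>i\<in>UNIV. \<Sum>j\<in>UNIV.
        christoffel (\<gamma> u) k i j * vector_derivative \<gamma> (at u) $ i * W u $ j)"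

definition E2 :: "pt \<Rightarrow> real ^ 3" where
  "E2 p = exp (p $ 3) *\<^sub>R axis 2 1"

definition E3 :: "pt \<Rightarrow> real ^ 3" where
  "E3 p = axis 3 1"

definition sol_translation1 :: "real \<Rightarrow> pt \<Rightarrow> pt" where
  "sol_translation1 c p = vector [p $ 1 + c, p $ 2, p $ 3]"

definition sol_translation2 :: "real \<Rightarrow> pt \<Rightarrow> pt" where
  "sol_translation2 b p = vector [p $ 1, p $ 2 + b, p $ 3]"

definition sol_dilation :: "real \<Rightarrow> pt \<Rightarrow> pt" where
  "sol_dilation l p = vector [exp l * p $ 1, exp (- l) * p $ 2, p $ 3 - l]"

definition leaf2 :: "real \<Rightarrow> pt set" where
  "leaf2 t = {p. p $ 2 = t}"

definition foliation2 :: "pt set set" where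
  "foliation2 = range leaf2"


section \<open>Invariant surfaces\<close>

definition smooth_on :: "real set \<Rightarrow> (real \<Rightarrow> real) \<Rightarrow> bool" where
  "smooth_on I f \<longleftrightarrow> (\<forall>n. \<forall>s\<in>I. (deriv ^^ n) f differentiable (at s))"

definition generating_curve ::
  "real set \<Rightarrow> (real \<Rightarrow> real) \<Rightarrow> (real \<Rightarrow> real) \<Rightarrow> (real \<Rightarrow> real) \<Rightarrow> bool" where
  "generating_curve I y z \<theta> \<longleftrightarrow>
     I \<noteq> {} \<and> open I \<and> is_interval I \<and>
     smooth_on I y \<and> smooth_on I z \<and> smooth_on I \<theta> \<and>
     (\<forall>s\<in>I. (y has_real_derivative exp (z s) * cos (\<theta> s)) (at s)) \<and>
     (\<forall>s\<in>I. (z has_real_derivative sin (\<theta> s)) (at s))"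

definition curve_alpha :: "(real \<Rightarrow> real) \<Rightarrow> (real \<Rightarrow> real) \<Rightarrow> real \<Rightarrow> pt" where
  "curve_alpha y z s = vector [0, y s, z s]"

definition surf_X :: "(real \<Rightarrow> real) \<Rightarrow> (real \<Rightarrow> real) \<Rightarrow> real \<Rightarrow> real \<Rightarrow> pt" where
  "surf_X y z s t = vector [t, y s, z s]"

definition invariant_surface :: "real set \<Rightarrow> (real \<Rightarrow> real) \<Rightarrow> (real \<Rightarrow> real) \<Rightarrow> pt set" where
  "invariant_surface I y z = {surf_X y z s t | s t. s \<in> I}"

definition surf_N ::
  "(real \<Rightarrow> real) \<Rightarrow> (real \<Rightarrow> real) \<Rightarrow> (real \<Rightarrow> real) \<Rightarrow> real \<Rightarrow> real \<Rightarrow> real ^ 3" where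
  "surf_N y z \<theta> s t =
     - sin (\<theta> s) *\<^sub>R E2 (surf_X y z s t) + cos (\<theta> s) *\<^sub>R E3 (surf_X y z s t)"

text \<open>The principal curvatures are the eigenvalues of the shape operator \<open>v \<mapsto> - \<nabla>\<^sub>v N\<close> for the
  eigenvectors \<open>X\<^sub>s\<close> and \<open>X\<^sub>t\<close>. That these are eigenvectors, so that the descriptions below are
  proper, is part of \<open>kappa1_eq\<close> and \<open>kappa2_eq\<close>.\<close>

definition kappa1 ::
  "(real \<Rightarrow> real) \<Rightarrow> (real \<Rightarrow> real) \<Rightarrow> (real \<Rightarrow> real) \<Rightarrow> real \<Rightarrow> real \<Rightarrow> real" where
  "kappa1 y z \<theta> s t =
     (THE k. - cov_deriv (\<lambda>u. surf_X y z u t) (\<lambda>u. surf_N y z \<theta> u t) s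
             = k *\<^sub>R vector_derivative (\<lambda>u. surf_X y z u t) (at s))"

definition kappa2 ::
  "(real \<Rightarrow> real) \<Rightarrow> (real \<Rightarrow> real) \<Rightarrow> (real \<Rightarrow> real) \<Rightarrow> real \<Rightarrow> real \<Rightarrow> real" where
  "kappa2 y z \<theta> s t =
     (THE k. - cov_deriv (\<lambda>u. surf_X y z s u) (\<lambda>u. surf_N y z \<theta> s u) t
             = k *\<^sub>R vector_derivative (\<lambda>u. surf_X y z s u) (at t))"

definition umbilical ::
  "real set \<Rightarrow> (real \<Rightarrow> real) \<Rightarrow> (real \<Rightarrow> real) \<Rightarrow> (real \<Rightarrow> real) \<Rightarrow> bool" where
  "umbilical I y z \<theta> \<longleftrightarrow> (\<forall>s\<in>I. \<forall>t. kappa1 y z \<theta> s t = kappa2 y z \<theta> s t)"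

definition minimal ::
  "real set \<Rightarrow> (real \<Rightarrow> real) \<Rightarrow> (real \<Rightarrow> real) \<Rightarrow> (real \<Rightarrow> real) \<Rightarrow> bool" where
  "minimal I y z \<theta> \<longleftrightarrow> (\<forall>s\<in>I. \<forall>t. kappa1 y z \<theta> s t + kappa2 y z \<theta> s t = 0)"

definition curvature_solution ::
  "real \<Rightarrow> real set \<Rightarrow> (real \<Rightarrow> real) \<Rightarrow> (real \<Rightarrow> real) \<Rightarrow> (real \<Rightarrow> real) \<Rightarrow> bool" where
  "curvature_solution m I y z \<theta> \<longleftrightarrow>
     generating_curve I y z \<theta> \<and>
     (\<forall>s\<in>I. \<forall>t. kappa1 y z \<theta> s t = m * kappa2 y z \<theta> s t)"

text \<open>By \<open>kappa1_eq\<close> and \<open>kappa2_eq\<close>, a curvature solution is a smooth solution on \<open>I\<close> of the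
  autonomous system \<open>y' = e\<^sup>z cos \<theta>\<close>, \<open>z' = sin \<theta>\<close>, \<open>\<theta>' = - (m + 1) cos \<theta>\<close>.\<close>

definition maximal_solution ::
  "real \<Rightarrow> real set \<Rightarrow> (real \<Rightarrow> real) \<Rightarrow> (real \<Rightarrow> real) \<Rightarrow> (real \<Rightarrow> real) \<Rightarrow> bool" where
  "maximal_solution m I y z \<theta> \<longleftrightarrow>
     curvature_solution m I y z \<theta> \<and>
     (\<forall>J y1 z1 \<theta>1. curvature_solution m J y1 z1 \<theta>1 \<and> I \<subseteq> J \<and>
        (\<forall>s\<in>I. y1 s = y s \<and> z1 s = z s \<and> \<theta>1 s = \<theta> s) \<longrightarrow> J = I)"


section \<open>Graphs \<open>z = f(y)\<close> in the plane \<open>x = 0\<close>\<close>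

definition graph_on :: "real set \<Rightarrow> (real \<Rightarrow> real) \<Rightarrow> pt set" where
  "graph_on D f = {vector [0, u, f u] | u. u \<in> D}"

definition local_min_on :: "real set \<Rightarrow> (real \<Rightarrow> real) \<Rightarrow> real \<Rightarrow> bool" where
  "local_min_on D f u \<longleftrightarrow> u \<in> D \<and> (\<forall>\<^sub>F v in at u within D. f u \<le> f v)"

definition local_max_on :: "real set \<Rightarrow> (real \<Rightarrow> real) \<Rightarrow> real \<Rightarrow> bool" where
  "local_max_on D f u \<longleftrightarrow> u \<in> D \<and> (\<forall>\<^sub>F v in at u within D. f u \<ge> f v)"

text \<open>A single minimum is a global minimum such that there is no other local minimum.\<close>

definition single_minimum :: "real set \<Rightarrow> (real \<Rightarrow> real) \<Rightarrow> bool" where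
  "single_minimum D f \<longleftrightarrow>
     (\<exists>u\<in>D. (\<forall>v\<in>D. f u \<le> f v) \<and> (\<forall>v. local_min_on D f v \<longrightarrow> v = u))"

definition single_maximum :: "real set \<Rightarrow> (real \<Rightarrow> real) \<Rightarrow> bool" where
  "single_maximum D f \<longleftrightarrow>
     (\<exists>u\<in>D. (\<forall>v\<in>D. f u \<ge> f v) \<and> (\<forall>v. local_max_on D f v \<longrightarrow> v = u))"

text \<open>The limit point condition excludes the vacuous case of a line away from the domain.\<close>

definition asymptotic_to_vertical_line :: "real set \<Rightarrow> (real \<Rightarrow> real) \<Rightarrow> real \<Rightarrow> bool" where
  "asymptotic_to_vertical_line D f y0 \<longleftrightarrow>
     y0 islimpt D \<and> filterlim (\<lambda>u. \<bar>f u\<bar>) at_top (at y0 within D)"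

text \<open>Equality up to integration constants is a relation between the traces of the curves, which
  do not change under the reparametrizations \<open>s \<mapsto> \<plusminus> s + s\<^sub>0\<close>. The group generated by
  the two families of isometries consists of the compositions used here.\<close>

definition equal_up_to_integration_constants :: "pt set \<Rightarrow> pt set \<Rightarrow> bool" where
  "equal_up_to_integration_constants A B \<longleftrightarrow>
     (\<exists>l b. (sol_dilation l \<circ> sol_translation2 b) ` A = B)"


section \<open>Principal curvatures of an invariant surface\<close>

lemma matrix_inv_sol_metric:
  "matrix_inv (sol_metric p) = vector [vector [exp (- 2 * p $ 3), 0, 0],
                          vector [0, exp (2 * p $ 3), 0],
                          vector [0, 0, 1]]" (is "_ = ?B")
proof -
  have e: "exp (2 * p $ 3) * exp (- (2 * p $ 3)) = 1" "exp (- (2 * p $ 3)) * exp (2 * p $ 3) = 1"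
    by (simp_all add: exp_minus)
  have 1: "sol_metric p ** ?B = mat 1" "?B ** sol_metric p = mat 1"
    unfolding sol_metric_def matrix_matrix_mult_def mat_def
    by (auto simp: vec_eq_iff forall_3 sum_3 e)
  show ?thesis
    unfolding matrix_inv_def
  proof (rule some_equality)
    show "sol_metric p ** ?B = mat 1 \<and> ?B ** sol_metric p = mat 1" using 1 by simp
    fix A' assume "sol_metric p ** A' = mat 1 \<and> A' ** sol_metric p = mat 1"
    then have "?B ** (sol_metric p ** A') = ?B" by (simp add: matrix_mul_rid)
    then show "A' = ?B" using 1 by (simp add: matrix_mul_assoc matrix_mul_lid)
  qed
qed

lemma partial_metric:
  "partial_deriv i (\<lambda>q. sol_metric q $ j $ k) p =
    (if i = 3 \<and> j = 1 \<and> k = 1 then 2 * exp (2 * p $ 3)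
     else if i = 3 \<and> j = 2 \<and> k = 2 then - 2 * exp (- 2 * p $ 3) else 0)"
proof -
  have d1: "((\<lambda>h. exp (2 * p $ 3 + 2 * h)) has_real_derivative 2 * exp (2 * p $ 3)) (at 0)"
    by (auto intro!: derivative_eq_intros)
  have d2: "((\<lambda>h. exp (- (2 * p $ 3) - 2 * h)) has_real_derivative - 2 * exp (- 2 * p $ 3)) (at 0)"
    by (auto intro!: derivative_eq_intros)
  show ?thesis
    using exhaust_3[of i] exhaust_3[of j] exhaust_3[of k]
    unfolding partial_deriv_def sol_metric_def
    by (auto simp: axis_def DERIV_imp_deriv[OF d1] DERIV_imp_deriv[OF d2])
qed

lemma christoffel_eq:
  "christoffel p k i j =
    (if k = 1 \<and> (i = 1 \<and> j = 3 \<or> i = 3 \<and> j = 1) then 1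
     else if k = 2 \<and> (i = 2 \<and> j = 3 \<or> i = 3 \<and> j = 2) then - 1
     else if k = 3 \<and> i = 1 \<and> j = 1 then - exp (2 * p $ 3)
     else if k = 3 \<and> i = 2 \<and> j = 2 then exp (- 2 * p $ 3) else 0)"
proof -
  have e: "exp (2 * p $ 3) * exp (- (2 * p $ 3)) = 1" "exp (- (2 * p $ 3)) * exp (2 * p $ 3) = 1"
    by (simp_all add: exp_minus)
  show ?thesis
    using exhaust_3[of k] exhaust_3[of i] exhaust_3[of j]
    by (elim disjE; hypsubst) (simp_all add: christoffel_def sum_3 matrix_inv_sol_metric partial_metric e)
qed

lemma has_vector_derivative_vector3:
  assumes "(a has_real_derivative a') (at s)" "(b has_real_derivative b') (at s)"
    "(c has_real_derivative c') (at s)"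
  shows "((\<lambda>u. vector [a u, b u, c u] :: real ^ 3) has_vector_derivative vector [a', b', c']) (at s)"
proof -
  have "(\<lambda>u. vector [a u, b u, c u] :: real ^ 3)
      = (\<lambda>u. a u *\<^sub>R axis 1 1 + b u *\<^sub>R axis 2 1 + c u *\<^sub>R axis 3 1)"
    by (auto simp: fun_eq_iff vec_eq_iff forall_3 axis_def)
  moreover have "(vector [a', b', c'] :: real ^ 3) = a' *\<^sub>R axis 1 1 + b' *\<^sub>R axis 2 1 + c' *\<^sub>R axis 3 1"
    by (auto simp: vec_eq_iff forall_3 axis_def)
  ultimately show ?thesis
    using assms by (auto intro!: derivative_eq_intros)
qed

lemma surf_N_eq:
  "surf_N y z \<theta> s t = vector [0, - sin (\<theta> s) * exp (z s), cos (\<theta> s)]"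
  by (auto simp: surf_N_def E2_def E3_def surf_X_def vec_eq_iff forall_3 axis_def)

lemma the_scale:
  fixes v w :: "'a :: real_vector"
  assumes "w = k *\<^sub>R v" "v \<noteq> 0"
  shows "(THE k. w = k *\<^sub>R v) = k"
  using assms by (auto intro!: the_equality)

lemma kappa1_eq:
  assumes "generating_curve I y z \<theta>" "s \<in> I"
  shows "- cov_deriv (\<lambda>u. surf_X y z u t) (\<lambda>u. surf_N y z \<theta> u t) s
          = (deriv \<theta> s + cos (\<theta> s)) *\<^sub>R vector_derivative (\<lambda>u. surf_X y z u t) (at s)"
    and "kappa1 y z \<theta> s t = deriv \<theta> s + cos (\<theta> s)"
proof -
  have y: "(y has_real_derivative exp (z s) * cos (\<theta> s)) (at s)"
    and z: "(z has_real_derivative sin (\<theta> s)) (at s)"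
    and sm: "smooth_on I \<theta>"
    using assms unfolding generating_curve_def by auto
  have "\<theta> differentiable (at s)"
    using sm assms(2) unfolding smooth_on_def by (metis funpow_0)
  then have \<theta>: "(\<theta> has_real_derivative deriv \<theta> s) (at s)"
    using DERIV_deriv_iff_real_differentiable by blast
  have X: "vector_derivative (\<lambda>u. surf_X y z u t) (at s) = vector [0, exp (z s) * cos (\<theta> s), sin (\<theta> s)]"
    unfolding surf_X_def
    by (rule vector_derivative_at, rule has_vector_derivative_vector3) (auto intro!: y z)
  have N: "vector_derivative (\<lambda>u. surf_N y z \<theta> u t) (at s)
     = vector [0, - cos (\<theta> s) * deriv \<theta> s * exp (z s) - sin (\<theta> s) * (exp (z s) * sin (\<theta> s)),
         - sin (\<theta> s) * deriv \<theta> s]"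
    unfolding surf_N_eq
    by (rule vector_derivative_at, rule has_vector_derivative_vector3)
       (auto intro!: derivative_eq_intros y z \<theta> simp: algebra_simps)
  have nz: "vector_derivative (\<lambda>u. surf_X y z u t) (at s) \<noteq> 0"
  proof
    assume "vector_derivative (\<lambda>u. surf_X y z u t) (at s) = 0"
    then have "sin (\<theta> s) = 0" "cos (\<theta> s) = 0"
      unfolding X by (auto simp: vec_eq_iff forall_3)
    then show False using sin_zero_abs_cos_one by fastforce
  qed
  have "exp (- (2 * z s)) * exp (z s) * exp (z s) = 1"
    by (simp flip: exp_add)
  then have e: "exp (- (2 * z s)) * (exp (z s) * cos (\<theta> s)) * (sin (\<theta> s) * exp (z s))
      = cos (\<theta> s) * sin (\<theta> s)"
    by algebra
  show *: "- cov_deriv (\<lambda>u. surf_X y z u t) (\<lambda>u. surf_N y z \<theta> u t) s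
          = (deriv \<theta> s + cos (\<theta> s)) *\<^sub>R vector_derivative (\<lambda>u. surf_X y z u t) (at s)"
    unfolding cov_deriv_def X N sum_3 christoffel_eq
    by (simp add: vec_eq_iff forall_3 surf_N_eq surf_X_def e) (simp add: algebra_simps)
  show "kappa1 y z \<theta> s t = deriv \<theta> s + cos (\<theta> s)"
    unfolding kappa1_def by (rule the_scale[OF * nz])
qed

lemma kappa2_eq:
  "- cov_deriv (\<lambda>u. surf_X y z s u) (\<lambda>u. surf_N y z \<theta> s u) t
     = (- cos (\<theta> s)) *\<^sub>R vector_derivative (\<lambda>u. surf_X y z s u) (at t)"
  "kappa2 y z \<theta> s t = - cos (\<theta> s)"
proof -
  have X: "vector_derivative (\<lambda>u. surf_X y z s u) (at t) = vector [1, 0, 0]"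
    unfolding surf_X_def
    by (rule vector_derivative_at, rule has_vector_derivative_vector3) (auto intro!: derivative_eq_intros)
  have N: "vector_derivative (\<lambda>u. surf_N y z \<theta> s u) (at t) = 0"
    unfolding surf_N_eq by simp
  have nz: "vector_derivative (\<lambda>u. surf_X y z s u) (at t) \<noteq> 0"
    unfolding X by (auto simp: vec_eq_iff forall_3)
  show *: "- cov_deriv (\<lambda>u. surf_X y z s u) (\<lambda>u. surf_N y z \<theta> s u) t
     = (- cos (\<theta> s)) *\<^sub>R vector_derivative (\<lambda>u. surf_X y z s u) (at t)"
    unfolding cov_deriv_def X N sum_3 christoffel_eq
    by (auto simp: vec_eq_iff forall_3 surf_N_eq surf_X_def algebra_simps)
  show "kappa2 y z \<theta> s t = - cos (\<theta> s)"
    unfolding kappa2_def by (rule the_scale[OF * nz])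
qed

lemma invariant_surface_invariant:
  "sol_translation1 c ` invariant_surface I y z = invariant_surface I y z"
proof -
  have *: "sol_translation1 c (surf_X y z s t) = surf_X y z s (t + c)" for c s t
    by (simp add: sol_translation1_def surf_X_def)
  have "surf_X y z s t = sol_translation1 c (surf_X y z s (t - c))" for s t
    by (simp add: *)
  then show ?thesis
    unfolding invariant_surface_def using * by blast
qed

end

theory Submission
  imports Defs
begin

text \<open>
  For \<open>m = \<plusminus>1\<close> the curvature condition \<open>\<kappa>\<^sub>1 = m \<kappa>\<^sub>2\<close> is by itself the umbilical or minimal one. The
  other claims concern \<open>m \<noteq> -1\<close> and rest on solving it.

  The curvature condition \<open>\<kappa>\<^sub>1 = m \<kappa>\<^sub>2\<close> reads \<open>\<theta>' = a cos \<theta>\<close> with \<open>a = - (m + 1)\<close>. This equation does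
  not involve \<open>y\<close> and \<open>z\<close>, and it can be solved explicitly on the whole line. Its right-hand side is
  Lipschitz, so \<open>\<theta>\<close> agrees with the explicit solution through one of its values, and \<open>z\<close> and \<open>y\<close>
  follow by integration. As the explicit solution lives on \<open>\<real>\<close>, a maximal solution does too
  (\<open>maximal_solution_is_global\<close>).

  If \<open>cos \<theta>\<close> vanishes somewhere, \<open>\<theta>\<close> is constant, \<open>y\<close> is constant and \<open>z\<close> runs over \<open>\<real>\<close> with speed
  \<open>\<plusminus>1\<close>: the surface is a leaf. Otherwise, if \<open>a \<noteq> 0\<close>, \<open>sin \<theta> = tanh (a v)\<close> and
  \<open>cos \<theta> = \<plusminus>1 / cosh (a v)\<close>, where \<open>v\<close> is the arc length measured from the point with horizontal
  tangent. With \<open>z\<^sub>0\<close> the height of that point, and with \<open>v\<close> oriented such that \<open>y\<close> increases, this gives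
  \<open>z = z\<^sub>0 + (1/a) log cosh (a v)\<close> and \<open>y' = e\<^bsup>z\<^sub>0\<^esup> (cosh (a v))\<^bsup>1/a - 1\<^esup>\<close>
  (\<open>nonvertical_solution_profile\<close>).

  Everything is read off from these two formulas. Since \<open>y' > 0\<close>, the curve is a graph over the range
  of \<open>y\<close>. The height is strictly monotone in \<open>\<bar>v\<bar>\<close> and unbounded; it has a minimum for \<open>a > 0\<close> (that is, \<open>m < -1\<close>) and a maximum for \<open>a < 0\<close>. The exponent \<open>1/a - 1\<close> decides about
  the width. It is negative for \<open>a < 0\<close> and for \<open>a > 1\<close> (that is, \<open>m > -1\<close> and
  \<open>m < -2\<close>, respectively); then \<open>y'\<close> decays exponentially, \<open>y\<close> is bounded, and the ends of its range are the two asymptotes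
  (\<open>profile_width_bounded\<close>, \<open>asymptotic_reparametrized\<close>). It is positive for \<open>0 < a < 1\<close>; then \<open>y'\<close> is
  bounded away from \<open>0\<close> and \<open>y\<close> is onto \<open>\<real>\<close> (\<open>profile_width_surjective\<close>). For \<open>a = 1\<close> it is zero, \<open>y\<close>
  is affine in \<open>v\<close>, and the curve is \<open>z = log cosh y\<close> after a translation and a dilation
  (\<open>profile_is_log_cosh\<close>).
\<close>

section \<open>The system of ordinary differential equations\<close>

text \<open>Gronwall's argument: the squared distance \<open>D\<close> of two solutions satisfies \<open>\<bar>D'\<bar> \<le> 2 L D\<close>, so
  \<open>D e\<^bsup>-2Ls\<^esup>\<close> decreases and \<open>D e\<^bsup>2Ls\<^esup>\<close> increases. Since \<open>D \<ge> 0\<close> vanishes at \<open>p\<close>, the former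
  gives \<open>D = 0\<close> to the right of \<open>p\<close> and the latter to the left.\<close>

lemma Lipschitz_ODE_unique:
  fixes F :: "real \<Rightarrow> real"
  assumes I: "is_interval I" "p \<in> I" "s \<in> I"
    and lip: "\<And>a b. \<bar>F a - F b\<bar> \<le> L * \<bar>a - b\<bar>"
    and f: "\<And>u. u \<in> I \<Longrightarrow> (f has_real_derivative F (f u)) (at u)"
    and g: "\<And>u. u \<in> I \<Longrightarrow> (g has_real_derivative F (g u)) (at u)"
    and "f p = g p"
  shows "f s = g s"
proof -
  define D where "D u = (f u - g u)\<^sup>2" for u
  define D' where "D' u = 2 * (f u - g u) * (F (f u) - F (g u))" for u
  have D: "(D has_real_derivative D' u) (at u)" if "u \<in> I" for u
    unfolding D_def D'_def
    by (auto intro!: derivative_eq_intros f g that)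
  have D'_bound: "\<bar>D' u\<bar> \<le> 2 * L * D u" for u
  proof -
    have "\<bar>D' u\<bar> = 2 * \<bar>f u - g u\<bar> * \<bar>F (f u) - F (g u)\<bar>"
      unfolding D'_def abs_mult by simp
    also have "\<dots> \<le> 2 * \<bar>f u - g u\<bar> * (L * \<bar>f u - g u\<bar>)"
      by (intro mult_left_mono lip) simp
    also have "\<dots> = 2 * L * (\<bar>f u - g u\<bar> * \<bar>f u - g u\<bar>)"
      by (simp only: mult_ac)
    also have "\<dots> = 2 * L * D u"
      by (simp only: D_def power2_eq_square abs_mult_self_eq)
    finally show ?thesis .
  qed
  have E: "((\<lambda>u. D u * exp (c * u)) has_real_derivative (D' u + c * D u) * exp (c * u)) (at u)"
    if "u \<in> I" for c u
    by (auto intro!: derivative_eq_intros D that simp: algebra_simps)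
  have between: "u \<in> I" if "p \<le> u \<and> u \<le> s \<or> s \<le> u \<and> u \<le> p" for u
    using I that unfolding is_interval_1 by blast
  have "D p = 0"
    using assms by (simp add: D_def)
  have "D s \<le> 0"
  proof (cases "p \<le> s")
    case True
    have "D s * exp (- (2 * L) * s) \<le> D p * exp (- (2 * L) * p)"
    proof (rule DERIV_nonpos_imp_nonincreasing[OF True], intro exI conjI)
      fix u assume "p \<le> u" "u \<le> s"
      then show "((\<lambda>u. D u * exp (- (2 * L) * u)) has_real_derivative
          (D' u + - (2 * L) * D u) * exp (- (2 * L) * u)) (at u)"
        by (intro E between) simp
      show "(D' u + - (2 * L) * D u) * exp (- (2 * L) * u) \<le> 0"
        using D'_bound[of u] by (intro mult_nonpos_nonneg) auto
    qed
    then show ?thesis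
      using \<open>D p = 0\<close> by (simp add: mult_le_0_iff)
  next
    case False
    then have "s \<le> p" by simp
    have "D s * exp (2 * L * s) \<le> D p * exp (2 * L * p)"
    proof (rule DERIV_nonneg_imp_nondecreasing[OF \<open>s \<le> p\<close>], intro exI conjI)
      fix u assume "s \<le> u" "u \<le> p"
      then show "((\<lambda>u. D u * exp (2 * L * u)) has_real_derivative
          (D' u + 2 * L * D u) * exp (2 * L * u)) (at u)"
        by (intro E between) simp
      show "(D' u + 2 * L * D u) * exp (2 * L * u) \<ge> 0"
        using D'_bound[of u] by (intro mult_nonneg_nonneg) auto
    qed
    then show ?thesis
      using \<open>D p = 0\<close> by (simp add: mult_le_0_iff)
  qed
  then show ?thesis by (simp add: D_def)
qed

lemma antiderivative_through_point:
  fixes f :: "real \<Rightarrow> real"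
  assumes "\<And>u. isCont f u"
  obtains F where "F p = c" "\<And>u. (F has_real_derivative f u) (at u)"
proof -
  obtain F where F: "\<And>u. (F has_real_derivative f u) (at u)"
    using einterval_antiderivative[of "-\<infinity>" \<infinity> f] assms
    by (auto simp: has_real_derivative_iff_has_vector_derivative)
  have "((\<lambda>u. F u + (c - F p)) has_real_derivative f u) (at u)" for u
    using F by (auto intro!: derivative_eq_intros)
  then show ?thesis
    using that[of "\<lambda>u. F u + (c - F p)"] by simp
qed

lemma equal_if_same_derivative:
  fixes f g :: "real \<Rightarrow> real"
  assumes "is_interval I" "p \<in> I" "s \<in> I" "f p = g p"
    and "\<And>u. u \<in> I \<Longrightarrow> (f has_real_derivative h u) (at u)"
    and "\<And>u. u \<in> I \<Longrightarrow> (g has_real_derivative h u) (at u)"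
  shows "f s = g s"
proof -
  have "((\<lambda>v. f v - g v) has_real_derivative 0) (at u within I)" if "u \<in> I" for u
    using DERIV_diff[OF assms(5)[OF that] assms(6)[OF that]]
    by (auto intro: DERIV_subset)
  then obtain c where "\<And>u. u \<in> I \<Longrightarrow> f u - g u = c"
    using has_field_derivative_zero_constant[of I "\<lambda>v. f v - g v"] assms(1)
    by (auto simp: is_interval_convex)
  from this[OF assms(3)] this[OF assms(2)] show ?thesis
    using assms(4) by linarith
qed

text \<open>The algebra of functions generated by \<open>B\<close>. If it contains derivatives of its generators, it is
  closed under differentiation by the product rule, so its elements are smooth. This yields the
  smoothness of solutions of polynomial systems without formulas for the higher derivatives.\<close>

inductive_set generated_functions :: "(real \<Rightarrow> real) set \<Rightarrow> (real \<Rightarrow> real) set"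
  for B where
    base: "f \<in> B \<Longrightarrow> f \<in> generated_functions B"
  | const: "(\<lambda>_. c) \<in> generated_functions B"
  | add: "f \<in> generated_functions B \<Longrightarrow> g \<in> generated_functions B \<Longrightarrow>
      (\<lambda>s. f s + g s) \<in> generated_functions B"
  | mult: "f \<in> generated_functions B \<Longrightarrow> g \<in> generated_functions B \<Longrightarrow>
      (\<lambda>s. f s * g s) \<in> generated_functions B"

lemma smooth_on_UNIV_if_derivatives_generated:
  assumes B: "\<And>f. f \<in> B \<Longrightarrow>
      \<exists>f' \<in> generated_functions B. \<forall>s. (f has_real_derivative f' s) (at s)"
    and f: "f \<in> generated_functions B"
  shows "smooth_on UNIV f"
proof -
  have der: "\<exists>f' \<in> generated_functions B. \<forall>s. (f has_real_derivative f' s) (at s)"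
    if "f \<in> generated_functions B" for f
    using that
  proof induction
    case (base f)
    then show ?case by (rule B)
  next
    case (const c)
    then show ?case by (auto intro!: bexI[OF _ generated_functions.const[of 0]])
  next
    case (add f g)
    then obtain f' g' where f'g': "f' \<in> generated_functions B" "g' \<in> generated_functions B"
      "\<And>s. (f has_real_derivative f' s) (at s)" "\<And>s. (g has_real_derivative g' s) (at s)"
      by auto
    then show ?case
      by (intro bexI[of _ "\<lambda>s. f' s + g' s"] generated_functions.add)
         (auto intro!: derivative_eq_intros)
  next
    case (mult f g)
    then obtain f' g' where f'g': "f' \<in> generated_functions B" "g' \<in> generated_functions B"
      "\<And>s. (f has_real_derivative f' s) (at s)" "\<And>s. (g has_real_derivative g' s) (at s)"
      by auto
    then show ?case
      using mult.hyps
      by (intro bexI[of _ "\<lambda>s. f' s * g s + g' s * f s"] generated_functions.add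
            generated_functions.mult)
         (auto intro!: derivative_eq_intros)
  qed
  have "deriv f \<in> generated_functions B" if f: "f \<in> generated_functions B" for f
  proof -
    obtain f' where f': "f' \<in> generated_functions B" "\<And>s. (f has_real_derivative f' s) (at s)"
      using der[OF f] by auto
    then have "deriv f = f'" using DERIV_imp_deriv by blast
    with f' show ?thesis by simp
  qed
  then have "(deriv ^^ n) f \<in> generated_functions B" for n
    using f by (induction n) auto
  then show ?thesis
    using der unfolding smooth_on_def by (metis real_differentiable_def)
qed

text \<open>Smoothness comes from the form of the equations: the derivatives of \<open>y\<close>, \<open>z\<close>, \<open>\<theta>\<close>, \<open>e\<^sup>z\<close>,
  \<open>cos \<theta>\<close> and \<open>sin \<theta>\<close> are polynomials in the last three.\<close>

lemma curvature_solution_UNIV: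
  assumes y: "\<And>s. (y has_real_derivative exp (z s) * cos (\<theta> s)) (at s)"
    and z: "\<And>s. (z has_real_derivative sin (\<theta> s)) (at s)"
    and \<theta>: "\<And>s. (\<theta> has_real_derivative - (m + 1) * cos (\<theta> s)) (at s)"
  shows "curvature_solution m UNIV y z \<theta>"
proof -
  define B where "B = {y, z, \<theta>, \<lambda>s. exp (z s), \<lambda>s. cos (\<theta> s), \<lambda>s. sin (\<theta> s)}"
  let ?G = "generated_functions B"
  have b: "(\<lambda>s. exp (z s)) \<in> ?G" "(\<lambda>s. cos (\<theta> s)) \<in> ?G" "(\<lambda>s. sin (\<theta> s)) \<in> ?G"
    by (auto intro!: generated_functions.base simp: B_def)
  have der: "\<exists>f' \<in> ?G. \<forall>s. (f has_real_derivative f' s) (at s)" if "f \<in> B" for f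
  proof -
    consider "f = y" | "f = z" | "f = \<theta>" | "f = (\<lambda>s. exp (z s))" | "f = (\<lambda>s. cos (\<theta> s))"
      | "f = (\<lambda>s. sin (\<theta> s))"
      using \<open>f \<in> B\<close> unfolding B_def by blast
    then show ?thesis
    proof cases
      case 1
      show ?thesis
        unfolding 1 by (rule bexI[of _ "\<lambda>s. exp (z s) * cos (\<theta> s)"])
          (intro allI y generated_functions.mult b)+
    next
      case 2
      show ?thesis
        unfolding 2 by (rule bexI[of _ "\<lambda>s. sin (\<theta> s)"]) (auto intro!: z b)
    next
      case 3
      show ?thesis
        unfolding 3 by (rule bexI[of _ "\<lambda>s. - (m + 1) * cos (\<theta> s)"])
          (intro allI \<theta> generated_functions.mult generated_functions.const b)+
    next
      case 4
      have "(\<lambda>s. exp (z s) * sin (\<theta> s)) \<in> ?G"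
        by (intro generated_functions.mult b)
      then show ?thesis
        unfolding 4 by (rule bexI[rotated]) (auto intro!: derivative_eq_intros z)
    next
      case 5
      have "(\<lambda>s. (m + 1) * (sin (\<theta> s) * cos (\<theta> s))) \<in> ?G"
        by (intro generated_functions.mult generated_functions.const b)
      then show ?thesis
        unfolding 5 by (rule bexI[rotated])
          (auto intro!: derivative_eq_intros \<theta> simp: algebra_simps)
    next
      case 6
      have "(\<lambda>s. - (m + 1) * (cos (\<theta> s) * cos (\<theta> s))) \<in> ?G"
        by (intro generated_functions.mult generated_functions.const b)
      then show ?thesis
        unfolding 6 by (rule bexI[rotated])
          (auto intro!: derivative_eq_intros \<theta> simp: algebra_simps)
    qed
  qed
  have "smooth_on UNIV y" "smooth_on UNIV z" "smooth_on UNIV \<theta>"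
    by (rule smooth_on_UNIV_if_derivatives_generated[OF der]; auto intro: generated_functions.base simp: B_def)+
  then have gc: "generating_curve UNIV y z \<theta>"
    using y z by (simp add: generating_curve_def)
  show ?thesis
    unfolding curvature_solution_def
    using gc kappa1_eq(2)[OF gc UNIV_I] kappa2_eq(2) DERIV_imp_deriv[OF \<theta>]
    by (simp add: algebra_simps)
qed

lemma curvature_solution_angle_ODE:
  assumes "curvature_solution m I y z \<theta>" "s \<in> I"
  shows "(\<theta> has_real_derivative - (m + 1) * cos (\<theta> s)) (at s)"
proof -
  have gc: "generating_curve I y z \<theta>" and eq: "kappa1 y z \<theta> s 0 = m * kappa2 y z \<theta> s 0"
    using assms unfolding curvature_solution_def by auto
  have "deriv \<theta> s = - (m + 1) * cos (\<theta> s)"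
    using eq kappa1_eq(2)[OF gc assms(2)] kappa2_eq(2) by (simp add: algebra_simps)
  moreover have "\<theta> differentiable (at s)"
    using gc assms(2) unfolding generating_curve_def smooth_on_def by (metis funpow_0)
  ultimately show ?thesis
    by (metis DERIV_deriv_iff_real_differentiable)
qed

lemma cos_Lipschitz: "\<bar>cos a - cos b\<bar> \<le> \<bar>a - b\<bar>" for a b :: real
proof -
  have "\<bar>cos a - cos b\<bar> = 2 * \<bar>sin ((a + b) / 2)\<bar> * \<bar>sin ((b - a) / 2)\<bar>"
    by (simp add: cos_diff_cos abs_mult)
  also have "\<dots> \<le> 2 * 1 * \<bar>(b - a) / 2\<bar>"
    by (intro mult_mono abs_sin_x_le_abs_x) auto
  finally show ?thesis by (simp add: abs_minus_commute)
qed

text \<open>The equation for the angle is decoupled from \<open>y\<close> and \<open>z\<close>. A global solution of it is therefore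
  all that is needed to extend a solution to \<open>\<real>\<close>: the other two functions are integrals.\<close>

lemma maximal_solution_is_global:
  assumes max: "maximal_solution m I y z \<theta>" and p: "p \<in> I"
    and \<theta>1: "\<And>s. (\<theta>1 has_real_derivative - (m + 1) * cos (\<theta>1 s)) (at s)"
    and "\<theta>1 p = \<theta> p"
  shows "I = UNIV" and "\<theta> = \<theta>1"
proof -
  have cs: "curvature_solution m I y z \<theta>"
    using max by (simp add: maximal_solution_def)
  then have gc: "generating_curve I y z \<theta>"
    by (simp add: curvature_solution_def)
  have I: "is_interval I"
    using gc by (simp add: generating_curve_def)
  have lip: "\<bar>- (m + 1) * cos a - - (m + 1) * cos b\<bar> \<le> \<bar>m + 1\<bar> * \<bar>a - b\<bar>" for a b :: real
  proof -
    have "- (m + 1) * cos a - - (m + 1) * cos b = - ((m + 1) * (cos a - cos b))"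
      by (simp add: algebra_simps)
    then have "\<bar>- (m + 1) * cos a - - (m + 1) * cos b\<bar> = \<bar>m + 1\<bar> * \<bar>cos a - cos b\<bar>"
      by (simp only: abs_minus_cancel abs_mult)
    then show ?thesis
      by (simp add: cos_Lipschitz mult_left_mono)
  qed
  have \<theta>_eq: "\<theta> s = \<theta>1 s" if "s \<in> I" for s
    using Lipschitz_ODE_unique[OF I p that lip, of \<theta> \<theta>1]
      curvature_solution_angle_ODE[OF cs] \<theta>1 assms(4) by simp
  have cont: "isCont \<theta>1 s" for s
    by (rule DERIV_isCont[OF \<theta>1])
  have "isCont (\<lambda>s. sin (\<theta>1 s)) s" for s
    by (intro continuous_intros cont)
  then obtain z1 where z1: "z1 p = z p" "\<And>s. (z1 has_real_derivative sin (\<theta>1 s)) (at s)"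
    using antiderivative_through_point[of "\<lambda>s. sin (\<theta>1 s)" p "z p"] by metis
  have contz: "isCont z1 s" for s
    by (rule DERIV_isCont[OF z1(2)])
  have "isCont (\<lambda>s. exp (z1 s) * cos (\<theta>1 s)) s" for s
    by (intro continuous_intros cont contz)
  then obtain y1 where y1: "y1 p = y p"
    "\<And>s. (y1 has_real_derivative exp (z1 s) * cos (\<theta>1 s)) (at s)"
    using antiderivative_through_point[of "\<lambda>s. exp (z1 s) * cos (\<theta>1 s)" p "y p"] by metis
  have z_eq: "z1 s = z s" if "s \<in> I" for s
    by (rule equal_if_same_derivative[OF I p that, of z1 z "\<lambda>s. sin (\<theta>1 s)"])
       (use gc z1 \<theta>_eq in \<open>auto simp: generating_curve_def\<close>)
  have y_eq: "y1 s = y s" if "s \<in> I" for s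
  proof (rule equal_if_same_derivative[OF I p that, of y1 y "\<lambda>s. exp (z1 s) * cos (\<theta>1 s)"])
    show "y1 p = y p" by (rule y1(1))
    show "(y1 has_real_derivative exp (z1 u) * cos (\<theta>1 u)) (at u)" for u by (rule y1(2))
    show "(y has_real_derivative exp (z1 u) * cos (\<theta>1 u)) (at u)" if "u \<in> I" for u
      using gc that \<theta>_eq[OF that] z_eq[OF that] by (auto simp: generating_curve_def)
  qed
  have "curvature_solution m UNIV y1 z1 \<theta>1"
    by (rule curvature_solution_UNIV) (intro y1 z1 \<theta>1)+
  then have "UNIV = I"
    using max y_eq z_eq \<theta>_eq[symmetric] unfolding maximal_solution_def
    by (metis subset_UNIV)
  then show "I = UNIV" "\<theta> = \<theta>1"
    using \<theta>_eq by auto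
qed

section \<open>Vertical curves\<close>

lemma vertical_solution_is_leaf:
  assumes max: "maximal_solution m I y z \<theta>" and p: "p \<in> I" and "cos (\<theta> p) = 0"
  shows "invariant_surface I y z \<in> foliation2"
proof -
  have I: "I = UNIV" and \<theta>: "\<theta> = (\<lambda>_. \<theta> p)"
    using maximal_solution_is_global[OF max p, of "\<lambda>_. \<theta> p"] assms by auto
  have der: "(y has_real_derivative exp (z s) * cos (\<theta> s)) (at s)"
    "(z has_real_derivative sin (\<theta> s)) (at s)" for s
    using max I
    by (auto simp: maximal_solution_def curvature_solution_def generating_curve_def)
  define \<epsilon> where "\<epsilon> = sin (\<theta> p)"
  have "\<epsilon> \<noteq> 0"
    using \<open>cos (\<theta> p) = 0\<close> sin_cos_squared_add[of "\<theta> p"] by (auto simp: \<epsilon>_def)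
  have cs: "cos (\<theta> s) = 0" "sin (\<theta> s) = \<epsilon>" for s
    using \<open>cos (\<theta> p) = 0\<close> unfolding \<epsilon>_def by (metis \<theta>)+
  have y: "y s = y p" for s
    by (rule equal_if_same_derivative[of UNIV p s y "\<lambda>_. y p" "\<lambda>_. 0"])
       (use der(1) cs in auto)
  have z: "z s = z p + \<epsilon> * (s - p)" for s
    by (rule equal_if_same_derivative[of UNIV p s z "\<lambda>s. z p + \<epsilon> * (s - p)" "\<lambda>_. \<epsilon>"])
       (use der(2) cs in \<open>auto intro!: derivative_eq_intros\<close>)
  have "invariant_surface I y z = leaf2 (y p)"
  proof
    show "invariant_surface I y z \<subseteq> leaf2 (y p)"
      using y by (auto simp: invariant_surface_def leaf2_def surf_X_def)
    show "leaf2 (y p) \<subseteq> invariant_surface I y z"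
    proof
      fix q :: pt assume "q \<in> leaf2 (y p)"
      then have "q $ 2 = y p" by (simp add: leaf2_def)
      define s where "s = p + (q $ 3 - z p) / \<epsilon>"
      have "z s = q $ 3"
        using \<open>\<epsilon> \<noteq> 0\<close> unfolding z[of s] by (simp add: s_def)
      moreover have "y s = q $ 2"
        using y[of s] \<open>q $ 2 = y p\<close> by simp
      ultimately have "q = surf_X y z s (q $ 1)"
        by (simp add: surf_X_def vec_eq_iff forall_3)
      then show "q \<in> invariant_surface I y z"
        using I unfolding invariant_surface_def by blast
    qed
  qed
  then show ?thesis by (simp add: foliation2_def)
qed

section \<open>The profile of a non-vertical curve\<close>

text \<open>The function \<open>arctan \<circ> sinh\<close> (the Gudermannian) solves \<open>\<phi>' = cos \<phi>\<close> and takes all values in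
  \<open>(-\<pi>/2, \<pi>/2)\<close>. Every angle with \<open>cos \<phi> \<noteq> 0\<close> is such a value up to a sign \<open>\<epsilon>\<close> and a multiple \<open>c\<close> of
  \<open>\<pi>\<close>. As \<open>\<epsilon> = cos c\<close>, the function \<open>c + \<epsilon> arctan (sinh v)\<close> solves the same equation, so these
  functions cover all initial values with \<open>cos \<phi> \<noteq> 0\<close>.\<close>

lemma angle_as_gudermannian:
  fixes \<phi> :: real
  assumes "cos \<phi> \<noteq> 0"
  obtains v \<epsilon> c where "\<epsilon> = 1 \<or> \<epsilon> = - 1" "cos c = \<epsilon>" "sin c = 0"
    "\<phi> = c + \<epsilon> * arctan (sinh v)"
proof -
  define \<epsilon> where "\<epsilon> = sgn (cos \<phi>)"
  \<comment> \<open>The absolute value makes \<open>\<psi>\<close> an angle with sine \<open>sin \<phi>\<close> and cosine \<open>\<bar>cos \<phi>\<bar>\<close>: up to \<open>2\<pi>\<close> it is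
    \<open>\<phi>\<close>, reflected in the vertical axis if \<open>cos \<phi> < 0\<close>.\<close>
  define v where "v = arsinh (sin \<phi> / \<bar>cos \<phi>\<bar>)"
  define \<psi> where "\<psi> = arctan (sinh v)"
  define c where "c = \<phi> - \<epsilon> * \<psi>"
  have \<epsilon>: "\<epsilon> = 1 \<or> \<epsilon> = - 1" and abs: "\<bar>cos \<phi>\<bar> = \<epsilon> * cos \<phi>" and pos: "\<epsilon> * cos \<phi> > 0"
    using assms by (auto simp: \<epsilon>_def sgn_if)
  have "sinh v = sin \<phi> / \<bar>cos \<phi>\<bar>"
    unfolding v_def by (rule sinh_arsinh_real)
  then have sinh: "sinh v = sin \<phi> / (\<epsilon> * cos \<phi>)"
    by (simp add: abs)
  have "1 + (sinh v)\<^sup>2 = (1 / (\<epsilon> * cos \<phi>))\<^sup>2"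
    using \<epsilon> assms sin_cos_squared_add[of \<phi>]
    by (auto simp: sinh power_divide power_mult_distrib field_simps)
  then have sq: "sqrt (1 + (sinh v)\<^sup>2) = 1 / (\<epsilon> * cos \<phi>)"
    using pos by (simp add: real_sqrt_unique)
  have cos: "cos \<psi> = \<epsilon> * cos \<phi>"
    unfolding \<psi>_def cos_arctan sq by simp
  have sin: "sin \<psi> = sin \<phi>"
    unfolding \<psi>_def sin_arctan sq using assms \<epsilon> by (auto simp: sinh)
  have "cos c = \<epsilon>" "sin c = 0"
    using \<epsilon> sin_cos_squared_add[of \<phi>]
    by (auto simp: c_def cos_diff sin_diff cos_add sin_add cos sin power2_eq_square)
  moreover have "\<phi> = c + \<epsilon> * arctan (sinh v)"
    by (simp add: c_def \<psi>_def)
  ultimately show ?thesis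
    using \<epsilon> that by blast
qed

lemma cos_arctan_sinh: "cos (arctan (sinh v)) = 1 / cosh v" for v :: real
proof -
  have "1 + (sinh v)\<^sup>2 = (cosh v)\<^sup>2" by (simp add: cosh_square_eq)
  then show ?thesis by (simp add: cos_arctan)
qed

lemma sin_arctan_sinh: "sin (arctan (sinh v)) = tanh v" for v :: real
proof -
  have "1 + (sinh v)\<^sup>2 = (cosh v)\<^sup>2" by (simp add: cosh_square_eq)
  then show ?thesis by (simp add: sin_arctan tanh_def)
qed

definition profile_height :: "real \<Rightarrow> real \<Rightarrow> real \<Rightarrow> real" where
  "profile_height a z0 v = z0 + ln (cosh (a * v)) / a"

lemma profile_height_0 [simp]: "profile_height a z0 0 = z0"
  by (simp add: profile_height_def)

lemma profile_height_minus [simp]: "profile_height a z0 (- v) = profile_height a z0 v"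
  by (simp add: profile_height_def)

lemma profile_height_derivative:
  assumes "a \<noteq> 0"
  shows "(profile_height a z0 has_real_derivative tanh (a * v)) (at v)"
  unfolding profile_height_def using assms
  by (auto intro!: derivative_eq_intros simp: tanh_def cosh_real_pos)

text \<open>The parameter \<open>v\<close> is the arc length, measured from the point with \<open>sin \<theta> = 0\<close> and reversed if
  \<open>cos \<theta> < 0\<close>. The height is even in \<open>v\<close>, so the reversal leaves it as it is and makes \<open>y\<close>
  increasing.\<close>

lemma nonvertical_solution_profile:
  assumes max: "maximal_solution m I y z \<theta>" and p: "p \<in> I" and "cos (\<theta> p) \<noteq> 0"
    and "m \<noteq> - 1" and a: "a = - (m + 1)"
  obtains Y z0 where
    "\<And>v. (Y has_real_derivative exp (profile_height a z0 v) / cosh (a * v)) (at v)"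
    "curve_alpha y z ` I = range (\<lambda>v. vector [0, Y v, profile_height a z0 v])"
proof -
  have a0: "a \<noteq> 0"
    using assms by simp
  obtain v0 \<epsilon> c where c: "\<epsilon> = 1 \<or> \<epsilon> = - 1" "cos c = \<epsilon>" "sin c = 0"
    "\<theta> p = c + \<epsilon> * arctan (sinh v0)"
    using angle_as_gudermannian[OF \<open>cos (\<theta> p) \<noteq> 0\<close>] .
  \<comment> \<open>The point of the curve with a horizontal tangent.\<close>
  define s0 where "s0 = p - v0 / a"
  define \<theta>1 where "\<theta>1 s = c + \<epsilon> * arctan (sinh (a * (s - s0)))" for s
  have cos1: "cos (\<theta>1 s) = \<epsilon> / cosh (a * (s - s0))" for s
    using c(1-3) by (auto simp: \<theta>1_def cos_add cos_diff cos_arctan_sinh)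
  have sin1: "sin (\<theta>1 s) = tanh (a * (s - s0))" for s
    using c(1-3) by (auto simp: \<theta>1_def sin_add sin_diff sin_arctan_sinh)
  have \<theta>1': "(\<theta>1 has_real_derivative a * cos (\<theta>1 s)) (at s)" for s
  proof -
    have "1 + (sinh (a * (s - s0)))\<^sup>2 = (cosh (a * (s - s0)))\<^sup>2"
      by (simp add: cosh_square_eq)
    then show ?thesis
      unfolding cos1 unfolding \<theta>1_def
      by (auto intro!: derivative_eq_intros simp: power2_eq_square field_simps)
  qed
  have "\<theta>1 p = \<theta> p"
    using a0 by (simp add: \<theta>1_def c(4) s0_def)
  then have I: "I = UNIV" and \<theta>: "\<theta> = \<theta>1"
    using maximal_solution_is_global[OF max p, of \<theta>1] \<theta>1' a by auto
  have der: "(y has_real_derivative exp (z s) * cos (\<theta> s)) (at s)"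
    "(z has_real_derivative sin (\<theta> s)) (at s)" for s
    using max I
    by (auto simp: maximal_solution_def curvature_solution_def generating_curve_def)
  define z0 where "z0 = z s0"
  have z: "z s = profile_height a z0 (s - s0)" for s
  proof (rule equal_if_same_derivative[of UNIV s0 s z _ "\<lambda>s. tanh (a * (s - s0))"])
    show "z s0 = profile_height a z0 (s0 - s0)" by (simp add: z0_def)
    show "(z has_real_derivative tanh (a * (u - s0))) (at u)" for u
      using der(2)[of u] by (simp add: \<theta> sin1)
    show "((\<lambda>s. profile_height a z0 (s - s0)) has_real_derivative tanh (a * (u - s0))) (at u)" for u
      by (rule DERIV_chain2[OF profile_height_derivative[OF a0], of "\<lambda>s. s - s0" 1 u UNIV, simplified])
         (auto intro!: derivative_eq_intros)
  qed auto
  define Y where "Y v = y (s0 + \<epsilon> * v)" for v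
  have Y: "(Y has_real_derivative exp (profile_height a z0 v) / cosh (a * v)) (at v)" for v
  proof -
    have "(Y has_real_derivative exp (z (s0 + \<epsilon> * v)) * cos (\<theta> (s0 + \<epsilon> * v)) * \<epsilon>) (at v)"
      unfolding Y_def
      by (rule DERIV_chain2[where f = y, OF der(1)]) (auto intro!: derivative_eq_intros)
    moreover have "exp (z (s0 + \<epsilon> * v)) * cos (\<theta> (s0 + \<epsilon> * v)) * \<epsilon>
        = exp (profile_height a z0 v) / cosh (a * v)"
      using c(1) by (auto simp: z \<theta> cos1)
    ultimately show ?thesis by simp
  qed
  have "surj (\<lambda>v. s0 + \<epsilon> * v)"
    using c(1) by (intro surjI[of _ "\<lambda>s. \<epsilon> * (s - s0)"]) auto
  then have "curve_alpha y z ` I = range (\<lambda>v. curve_alpha y z (s0 + \<epsilon> * v))"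
    unfolding I by (metis image_image)
  also have "\<dots> = range (\<lambda>v. vector [0, Y v, profile_height a z0 v])"
    using c(1) by (auto simp: curve_alpha_def Y_def z)
  finally show ?thesis
    using that[of Y z0] Y by blast
qed


section \<open>Curves that are graphs\<close>

lemma range_eq_graph_on:
  assumes "inj Y"
  shows "range (\<lambda>v. vector [0, Y v, Z v]) = graph_on (range Y) (\<lambda>u. Z (inv Y u))"
proof -
  have "graph_on (range Y) (\<lambda>u. Z (inv Y u)) = (\<lambda>u. vector [0, u, Z (inv Y u)]) ` range Y"
    unfolding graph_on_def by (simp only: Setcompr_eq_image Collect_mem_eq)
  also have "\<dots> = range (\<lambda>v. vector [0, Y v, Z v])"
    using assms by (simp add: image_image)
  finally show ?thesis ..
qed

text \<open>\<open>Z\<close> is strictly smaller nearer to \<open>0\<close>, so the minimum is attained at \<open>Y 0\<close>. At a point \<open>Y v\<close> with \<open>v \<noteq> 0\<close>,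
  moving \<open>v\<close> towards \<open>0\<close> decreases the function, and by continuity of \<open>Y\<close> this happens arbitrarily
  close to \<open>Y v\<close>; hence there is no other local minimum.\<close>

lemma single_minimum_reparametrized:
  fixes Y Z :: "real \<Rightarrow> real"
  assumes mono: "strict_mono Y" and cont: "\<And>v. isCont Y v"
    and Z: "\<And>v w. \<bar>v\<bar> < \<bar>w\<bar> \<Longrightarrow> Z v < Z w"
  shows "single_minimum (range Y) (\<lambda>u. Z (inv Y u))"
proof -
  have inj: "inj Y" using mono by (rule strict_mono_imp_inj_on)
  define f where "f u = Z (inv Y u)" for u
  have f: "f (Y v) = Z v" for v
    using inj by (simp add: f_def)
  have min: "Z 0 \<le> Z v" for v
    using Z[of 0 v] by (cases "v = 0") auto
  have unique: "v = 0" if loc: "local_min_on (range Y) f (Y v)" for v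
  proof (rule ccontr)
    assume "v \<noteq> 0"
    \<comment> \<open>The filter of \<open>w\<close> that approach \<open>v\<close> from the side of \<open>0\<close>.\<close>
    define F where "F = (if v > 0 then at_left v else at_right v)"
    have "F \<noteq> bot" by (simp add: F_def)
    have "filterlim Y (at (Y v) within range Y) F"
    proof -
      have "F \<le> at v" by (simp add: F_def at_le)
      then have "(Y \<longlongrightarrow> Y v) F"
        using cont[of v] by (auto simp: isCont_def intro: tendsto_mono)
      moreover have "eventually (\<lambda>w. w \<noteq> v) F"
        using \<open>F \<le> at v\<close> eventually_neq_at_within[of v v UNIV]
        by (auto simp: le_filter_def)
      then have "eventually (\<lambda>w. Y w \<in> range Y \<and> Y w \<noteq> Y v) F"
        by eventually_elim (use inj in \<open>auto simp: inj_def\<close>)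
      ultimately show ?thesis by (simp add: filterlim_at)
    qed
    then have "eventually (\<lambda>w. f (Y v) \<le> f (Y w)) F"
      using loc by (auto simp: local_min_on_def filterlim_iff)
    moreover have "eventually (\<lambda>w. \<bar>w\<bar> < \<bar>v\<bar>) F"
    proof (cases "v > 0")
      case True
      then have "eventually (\<lambda>w. w \<in> {0<..<v}) (at_left v)"
        by (intro eventually_at_left_real)
      then show ?thesis
        using True by (auto simp: F_def elim: eventually_mono)
    next
      case False
      then have "eventually (\<lambda>w. w \<in> {v<..<0}) (at_right v)"
        using \<open>v \<noteq> 0\<close> by (intro eventually_at_right_real) auto
      then show ?thesis
        using False by (auto simp: F_def elim: eventually_mono)
    qed
    ultimately have "eventually (\<lambda>w. False) F"
      by eventually_elim (use Z[of _ v] in \<open>force simp: f\<close>)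
    then show False
      using \<open>F \<noteq> bot\<close> by simp
  qed
  show ?thesis
    unfolding single_minimum_def f_def[symmetric]
  proof (rule bexI[of _ "Y 0"], intro conjI ballI allI impI)
    show "f (Y 0) \<le> f u" if "u \<in> range Y" for u
      using that min by (auto simp: f)
    show "u = Y 0" if "local_min_on (range Y) f u" for u
      using that unique by (force simp: local_min_on_def)
  qed simp
qed

lemma single_maximum_iff_minimum_uminus:
  "single_maximum D f \<longleftrightarrow> single_minimum D (\<lambda>u. - f u)"
  by (simp add: single_maximum_def single_minimum_def local_max_on_def local_min_on_def)

text \<open>The bounds of the range are not attained, because \<open>Y (v \<plusminus> 1)\<close> lies strictly beyond \<open>Y v\<close>; the
  values between them are attained by the intermediate value theorem.\<close>

lemma range_bounded_strict_mono:
  fixes Y :: "real \<Rightarrow> real"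
  assumes mono: "strict_mono Y" and cont: "\<And>v. isCont Y v"
    and bdd: "bdd_above (range Y)" "bdd_below (range Y)"
  shows "range Y = {Inf (range Y)<..<Sup (range Y)}"
proof
  show "range Y \<subseteq> {Inf (range Y)<..<Sup (range Y)}"
  proof clarsimp
    fix v
    have "Inf (range Y) \<le> Y (v - 1)" "Y (v + 1) \<le> Sup (range Y)"
      using bdd by (auto intro: cInf_lower cSup_upper)
    moreover have "Y (v - 1) < Y v" "Y v < Y (v + 1)"
      using mono by (auto simp: strict_mono_less)
    ultimately show "Inf (range Y) < Y v \<and> Y v < Sup (range Y)" by linarith
  qed
  show "{Inf (range Y)<..<Sup (range Y)} \<subseteq> range Y"
  proof
    fix u assume u: "u \<in> {Inf (range Y)<..<Sup (range Y)}"
    obtain v w where "Y v < u" "u < Y w"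
      using u bdd by (auto simp: cInf_less_iff less_cSup_iff)
    then have "v \<le> w"
      using mono by (meson less_trans strict_mono_less less_imp_le)
    then show "u \<in> range Y"
      using IVT[of Y v u w] \<open>Y v < u\<close> \<open>u < Y w\<close> cont by force
  qed
qed

text \<open>The inverse of \<open>Y\<close> is monotone and onto \<open>\<real>\<close>, so it tends to \<open>\<plusminus>\<infinity>\<close> at the ends of its domain, where
  \<open>\<bar>Z\<bar>\<close> tends to \<open>\<infinity>\<close>.\<close>

lemma asymptotic_reparametrized:
  fixes Y Z :: "real \<Rightarrow> real"
  assumes mono: "strict_mono Y" and range: "range Y = {y1<..<y2}"
    and Z: "filterlim (\<lambda>v. \<bar>Z v\<bar>) at_top at_top" "filterlim (\<lambda>v. \<bar>Z v\<bar>) at_top at_bot"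
  shows "asymptotic_to_vertical_line {y1<..<y2} (\<lambda>u. Z (inv Y u)) y1"
    and "asymptotic_to_vertical_line {y1<..<y2} (\<lambda>u. Z (inv Y u)) y2"
proof -
  have inj: "inj Y" using mono by (rule strict_mono_imp_inj_on)
  have Y: "y1 < Y v" "Y v < y2" for v
    using range by (auto simp: set_eq_iff)
  have "y1 < y2" using Y[of 0] by simp
  have "filterlim (inv Y) at_bot (at y1 within {y1<..<y2})"
    unfolding filterlim_at_bot
  proof
    fix b
    have "eventually (\<lambda>u. u < Y b) (at y1 within {y1<..<y2})"
      by (rule order_tendstoD(2)[OF tendsto_ident_at Y(1)])
    moreover have "eventually (\<lambda>u. u \<in> {y1<..<y2}) (at y1 within {y1<..<y2})"
      by (simp add: eventually_at_filter)
    ultimately show "eventually (\<lambda>u. inv Y u \<le> b) (at y1 within {y1<..<y2})"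
    proof eventually_elim
      case (elim u)
      then obtain v where "u = Y v" using range by blast
      then show ?case using elim inj mono by (auto simp: strict_mono_less)
    qed
  qed
  moreover have "filterlim (inv Y) at_top (at y2 within {y1<..<y2})"
    unfolding filterlim_at_top
  proof
    fix b
    have "eventually (\<lambda>u. Y b < u) (at y2 within {y1<..<y2})"
      by (rule order_tendstoD(1)[OF tendsto_ident_at Y(2)])
    moreover have "eventually (\<lambda>u. u \<in> {y1<..<y2}) (at y2 within {y1<..<y2})"
      by (simp add: eventually_at_filter)
    ultimately show "eventually (\<lambda>u. b \<le> inv Y u) (at y2 within {y1<..<y2})"
    proof eventually_elim
      case (elim u)
      then obtain v where "u = Y v" using range by blast
      then show ?case using elim inj mono by (auto simp: strict_mono_less)
    qed
  qed
  ultimately show "asymptotic_to_vertical_line {y1<..<y2} (\<lambda>u. Z (inv Y u)) y1"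
    "asymptotic_to_vertical_line {y1<..<y2} (\<lambda>u. Z (inv Y u)) y2"
    using \<open>y1 < y2\<close> Z
    by (auto simp: asymptotic_to_vertical_line_def islimpt_greaterThanLessThan1
        islimpt_greaterThanLessThan2 intro: filterlim_compose)
qed

section \<open>Growth of the profile\<close>

text \<open>To the right of \<open>0\<close>, \<open>g + (C/b) e\<^bsup>-bv\<^esup>\<close> is nonincreasing; to the left, \<open>g \<le> g 0\<close> by
  monotonicity.\<close>

lemma bounded_above_if_exponential_derivative:
  fixes g g' :: "real \<Rightarrow> real"
  assumes g: "\<And>v. (g has_real_derivative g' v) (at v)"
    and g': "\<And>v. 0 \<le> g' v" "\<And>v. g' v \<le> C * exp (- b * v)" and "b > 0"
  shows "g v \<le> g 0 + C / b"
proof -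
  have "0 \<le> C"
    using g'(1)[of 0] g'(2)[of 0] by simp
  show ?thesis
  proof (cases "v \<ge> 0")
    case True
    have "g v + C / b * exp (- b * v) \<le> g 0 + C / b * exp (- b * 0)"
    proof (rule DERIV_nonpos_imp_nonincreasing[OF True], intro exI conjI)
      fix u
      show "((\<lambda>v. g v + C / b * exp (- b * v)) has_real_derivative g' u - C * exp (- b * u)) (at u)"
        using \<open>b > 0\<close> by (auto intro!: derivative_eq_intros g)
      show "g' u - C * exp (- b * u) \<le> 0" using g'(2)[of u] by simp
    qed
    moreover have "0 \<le> C / b * exp (- b * v)"
      using \<open>0 \<le> C\<close> \<open>b > 0\<close> by simp
    ultimately show ?thesis by simp
  next
    case False
    then have "g v \<le> g 0"
      using g g'(1) by (intro DERIV_nonneg_imp_nondecreasing[of v 0 g]) auto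
    then show ?thesis using \<open>0 \<le> C\<close> \<open>b > 0\<close> by (simp add: add_increasing2)
  qed
qed

text \<open>The right-hand side is \<open>e\<^bsup>z\<^sub>0\<^esup> (cosh (a v))\<^bsup>1/a - 1\<^esup>\<close>; the sign of the exponent decides
  about the growth of \<open>y\<close>.\<close>

lemma exp_profile_height_div_cosh:
  "exp (profile_height a z0 v) / cosh (a * v) = exp z0 * exp ((1 / a - 1) * ln (cosh (a * v)))"
proof -
  have "exp z0 * exp ((1 / a - 1) * ln (cosh (a * v)))
      = exp (z0 + ln (cosh (a * v)) / a - ln (cosh (a * v)))"
    by (simp add: algebra_simps flip: exp_add)
  also have "\<dots> = exp (profile_height a z0 v) / cosh (a * v)"
    by (simp add: exp_diff profile_height_def)
  finally show ?thesis ..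
qed

lemma ln_cosh_ge: "\<bar>x\<bar> - ln 2 \<le> ln (cosh x)" for x :: real
proof -
  have "exp \<bar>x\<bar> / 2 \<le> cosh \<bar>x\<bar>"
    by (simp add: cosh_field_def)
  then have "exp \<bar>x\<bar> / 2 \<le> cosh x" by simp
  then have "ln (exp \<bar>x\<bar> / 2) \<le> ln (cosh x)"
    by (subst ln_le_cancel_iff) auto
  then show ?thesis by (simp add: ln_div)
qed

text \<open>With \<open>q = 1 - 1/a > 0\<close> and \<open>cosh x \<ge> e\<^bsup>\<bar>x\<bar>\<^esup> / 2\<close>, the derivative of \<open>Y\<close> is at most a multiple
  of \<open>e\<^bsup>-q\<bar>a\<bar>v\<^esup>\<close>. It is even, so the bound from above also applies to the reflection
  \<open>- Y (- v)\<close> and gives the bound from below.\<close>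

lemma profile_width_bounded:
  assumes Y: "\<And>v. (Y has_real_derivative exp (profile_height a z0 v) / cosh (a * v)) (at v)"
    and a: "a < 0 \<or> a > 1"
  shows "bdd_above (range Y)" and "bdd_below (range Y)"
proof -
  define q where "q = 1 - 1 / a"
  have q: "q > 0" using a by (auto simp: q_def field_simps)
  define C where "C = exp z0 * exp (q * ln 2)"
  let ?Y' = "\<lambda>v. exp (profile_height a z0 v) / cosh (a * v)"
  have nonneg: "0 \<le> ?Y' v" for v by simp
  have decay: "?Y' v \<le> C * exp (- (q * \<bar>a\<bar>) * v)" for v
  proof -
    have "\<bar>a\<bar> * v - ln 2 \<le> ln (cosh (a * v))"
      using ln_cosh_ge[of "a * v"] mult_left_mono[OF abs_ge_self[of v] abs_ge_zero[of a]]
      unfolding abs_mult by linarith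
    then have "(1 / a - 1) * ln (cosh (a * v)) \<le> (1 / a - 1) * (\<bar>a\<bar> * v - ln 2)"
      using q by (intro mult_left_mono_neg) (auto simp: q_def)
    also have "\<dots> = q * ln 2 + - (q * \<bar>a\<bar>) * v"
      by (simp add: q_def algebra_simps)
    finally have "exp ((1 / a - 1) * ln (cosh (a * v))) \<le> exp (q * ln 2) * exp (- (q * \<bar>a\<bar>) * v)"
      by (simp flip: exp_add)
    then show ?thesis
      unfolding exp_profile_height_div_cosh C_def by (simp add: mult.assoc)
  qed
  have b: "q * \<bar>a\<bar> > 0" using q a by (intro mult_pos_pos) auto
  have "Y v \<le> Y 0 + C / (q * \<bar>a\<bar>)" for v
    by (rule bounded_above_if_exponential_derivative[OF Y nonneg decay b])
  then show "bdd_above (range Y)" by (rule bdd_aboveI2)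
  have Y_reflected: "((\<lambda>v. - Y (- v)) has_real_derivative ?Y' v) (at v)" for v
    using DERIV_minus[OF DERIV_chain2[OF Y[of "- v"] DERIV_minus[OF DERIV_ident]]]
    by simp
  have reflected_bound: "- Y (- v) \<le> - Y (- 0) + C / (q * \<bar>a\<bar>)" for v
    by (rule bounded_above_if_exponential_derivative[OF Y_reflected nonneg decay b])
  have "Y 0 - C / (q * \<bar>a\<bar>) \<le> Y v" for v
    using reflected_bound[of "- v"] by simp
  then show "bdd_below (range Y)" by (rule bdd_belowI2)
qed

text \<open>Here \<open>1/a - 1 > 0\<close> and \<open>cosh \<ge> 1\<close>, so \<open>Y\<close> grows at least at the constant rate \<open>e\<^bsup>z\<^sub>0\<^esup>\<close>.\<close>

lemma profile_width_surjective:
  assumes Y: "\<And>v. (Y has_real_derivative exp (profile_height a z0 v) / cosh (a * v)) (at v)"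
    and a: "0 < a" "a < 1"
  shows "surj Y"
proof -
  have slope: "exp z0 \<le> exp (profile_height a z0 v) / cosh (a * v)" for v
  proof -
    have "0 \<le> (1 / a - 1) * ln (cosh (a * v))"
      using a cosh_real_ge_1 by (intro mult_nonneg_nonneg ln_ge_zero) auto
    then show ?thesis
      unfolding exp_profile_height_div_cosh by simp
  qed
  have incr: "Y u + exp z0 * (v - u) \<le> Y v" if "u \<le> v" for u v
  proof -
    have "Y u - exp z0 * u \<le> Y v - exp z0 * v"
    proof (rule DERIV_nonneg_imp_nondecreasing[OF that], intro exI conjI)
      fix w
      show "((\<lambda>v. Y v - exp z0 * v) has_real_derivative
          exp (profile_height a z0 w) / cosh (a * w) - exp z0) (at w)"
        by (auto intro!: derivative_eq_intros Y)
      show "0 \<le> exp (profile_height a z0 w) / cosh (a * w) - exp z0"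
        using slope[of w] by simp
    qed
    then show ?thesis by (simp add: algebra_simps)
  qed
  show ?thesis
    unfolding surj_def
  proof
    fix u
    define d where "d = \<bar>u - Y 0\<bar> / exp z0"
    have "d \<ge> 0" "exp z0 * d = \<bar>u - Y 0\<bar>" by (simp_all add: d_def)
    then have "Y (- d) \<le> u" "u \<le> Y d" "- d \<le> d"
      using incr[of "- d" 0] incr[of 0 d] by auto
    then show "\<exists>v. u = Y v"
      using IVT[of Y "- d" u d] DERIV_isCont[OF Y] by metis
  qed
qed

lemma profile_height_less:
  assumes "\<bar>v\<bar> < \<bar>w\<bar>" "a \<noteq> 0"
  shows "a > 0 \<Longrightarrow> profile_height a z0 v < profile_height a z0 w"
    and "a < 0 \<Longrightarrow> profile_height a z0 w < profile_height a z0 v"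
proof -
  have "cosh \<bar>a * v\<bar> < cosh \<bar>a * w\<bar>"
    using assms by (subst cosh_real_nonneg_less_iff) (auto simp: abs_mult)
  then have "ln (cosh (a * v)) < ln (cosh (a * w))" by simp
  then show "a > 0 \<Longrightarrow> profile_height a z0 v < profile_height a z0 w"
    "a < 0 \<Longrightarrow> profile_height a z0 w < profile_height a z0 v"
    by (simp_all add: profile_height_def divide_strict_right_mono divide_strict_right_mono_neg)
qed

lemma profile_height_unbounded:
  assumes "a \<noteq> 0"
  shows "filterlim (\<lambda>v. \<bar>profile_height a z0 v\<bar>) at_top at_top"
    and "filterlim (\<lambda>v. \<bar>profile_height a z0 v\<bar>) at_top at_bot"
proof -
  have "\<bar>v\<bar> - (ln 2 / \<bar>a\<bar> + \<bar>z0\<bar>) \<le> \<bar>profile_height a z0 v\<bar>" for v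
  proof -
    have "\<bar>v\<bar> - ln 2 / \<bar>a\<bar> = (\<bar>a * v\<bar> - ln 2) / \<bar>a\<bar>"
      using assms by (simp add: abs_mult field_simps)
    also have "\<dots> \<le> ln (cosh (a * v)) / \<bar>a\<bar>"
      using ln_cosh_ge by (intro divide_right_mono) auto
    also have "\<dots> \<le> \<bar>ln (cosh (a * v)) / a\<bar>"
      by (simp add: abs_divide divide_right_mono)
    finally show ?thesis unfolding profile_height_def by linarith
  qed
  moreover have "filterlim (\<lambda>v. \<bar>v\<bar> - c) at_top at_top" for c :: real
    unfolding filterlim_at_top
  proof
    fix K
    show "eventually (\<lambda>v. K \<le> \<bar>v\<bar> - c) at_top"
      using eventually_ge_at_top[of "K + c"] by eventually_elim simp
  qed
  moreover have "filterlim (\<lambda>v. \<bar>v\<bar> - c) at_top at_bot" for c :: real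
    using calculation(2)[of c] by (simp add: filterlim_at_bot_mirror)
  ultimately show "filterlim (\<lambda>v. \<bar>profile_height a z0 v\<bar>) at_top at_top"
    "filterlim (\<lambda>v. \<bar>profile_height a z0 v\<bar>) at_top at_bot"
    by (blast intro: filterlim_at_top_mono always_eventually)+
qed

text \<open>For \<open>a = 1\<close>, \<open>Y v = Y 0 + e\<^bsup>z\<^sub>0\<^esup> v\<close>. The translation by \<open>- Y 0\<close> removes the constant, and the
  dilation with parameter \<open>z\<^sub>0\<close> both scales \<open>y\<close> by \<open>e\<^bsup>-z\<^sub>0\<^esup>\<close> and lowers \<open>z\<close> by \<open>z\<^sub>0\<close>.\<close>

lemma profile_is_log_cosh:
  assumes Y: "\<And>v. (Y has_real_derivative exp (profile_height 1 z0 v) / cosh (1 * v)) (at v)"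
  shows "equal_up_to_integration_constants (range (\<lambda>v. vector [0, Y v, profile_height 1 z0 v]))
    (graph_on UNIV (\<lambda>u. ln (cosh u)))"
proof -
  have Y_eq: "Y v = Y 0 + exp z0 * v" for v
    by (rule equal_if_same_derivative[of UNIV 0 v Y "\<lambda>v. Y 0 + exp z0 * v" "\<lambda>_. exp z0"])
       (use Y exp_profile_height_div_cosh[of 1 z0] in \<open>auto intro!: derivative_eq_intros\<close>)
  have "(sol_dilation z0 \<circ> sol_translation2 (- Y 0)) (vector [0, Y v, profile_height 1 z0 v])
      = vector [0, v, ln (cosh v)]" for v
  proof -
    have "exp (- z0) * exp z0 = 1" by (simp add: exp_minus)
    then have e: "exp (- z0) * (exp z0 * v) = v" by (simp only: mult.assoc[symmetric] mult_1)
    then show ?thesis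
      unfolding Y_eq[of v] by (simp add: sol_dilation_def sol_translation2_def profile_height_def e)
  qed
  then have "(sol_dilation z0 \<circ> sol_translation2 (- Y 0)) `
      range (\<lambda>v. vector [0, Y v, profile_height 1 z0 v]) = graph_on UNIV (\<lambda>u. ln (cosh u))"
    unfolding graph_on_def image_image by auto
  then show ?thesis
    unfolding equal_up_to_integration_constants_def by blast
qed

section \<open>The classification\<close>

theorem theorem5p1:
  fixes m :: real and I :: "real set" and y z \<theta> :: "real \<Rightarrow> real" and S :: "(real ^ 3) set"
  assumes "maximal_solution m I y z \<theta>"
    and "S = invariant_surface I y z"
  shows "S \<in> foliation2 \<or>
    ((m = 1 \<longrightarrow> umbilical I y z \<theta>) \<and>
     (m = - 1 \<longrightarrow> minimal I y z \<theta>) \<and>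
     (m > - 1 \<or> m < - 2 \<longrightarrow>
       (\<exists>y1 y2 f. y1 < y2 \<and>
          curve_alpha y z ` I = graph_on {y1<..<y2} f \<and>
          (m < - 2 \<longrightarrow> single_minimum {y1<..<y2} f) \<and>
          (m > - 1 \<longrightarrow> single_maximum {y1<..<y2} f) \<and>
          asymptotic_to_vertical_line {y1<..<y2} f y1 \<and>
          asymptotic_to_vertical_line {y1<..<y2} f y2)) \<and>
     (- 2 < m \<and> m < - 1 \<longrightarrow>
       (\<exists>f. curve_alpha y z ` I = graph_on UNIV f \<and> single_minimum UNIV f)) \<and>
     (m = - 2 \<longrightarrow>
       equal_up_to_integration_constants (curve_alpha y z ` I)
         (graph_on UNIV (\<lambda>u. ln (cosh u)))))"
proof -
  have cs: "curvature_solution m I y z \<theta>"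
    using assms(1) by (simp add: maximal_solution_def)
  then obtain p where p: "p \<in> I"
    by (auto simp: curvature_solution_def generating_curve_def)
  have umbilical: "umbilical I y z \<theta>" if "m = 1"
    using cs that by (simp add: curvature_solution_def umbilical_def)
  have minimal: "minimal I y z \<theta>" if "m = - 1"
    using cs that by (simp add: curvature_solution_def minimal_def)
  consider "cos (\<theta> p) = 0" | "m = - 1" | "cos (\<theta> p) \<noteq> 0" "m \<noteq> - 1" by blast
  then show ?thesis
  proof cases
    case 1
    then show ?thesis
      using vertical_solution_is_leaf[OF assms(1) p] assms(2) by blast
  next
    case 2
    then show ?thesis using minimal by auto
  next
    case 3
    define a where "a = - (m + 1)"
    have "a \<noteq> 0" using 3 by (simp add: a_def)
    obtain Y z0 where
      Y: "\<And>v. (Y has_real_derivative exp (profile_height a z0 v) / cosh (a * v)) (at v)" and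
      trace: "curve_alpha y z ` I = range (\<lambda>v. vector [0, Y v, profile_height a z0 v])"
      using nonvertical_solution_profile[OF assms(1) p 3 a_def] by blast
    let ?f = "\<lambda>u. profile_height a z0 (inv Y u)"
    have mono: "strict_mono Y"
      by (rule strict_monoI, rule DERIV_pos_imp_increasing) (use Y in \<open>auto intro!: exI\<close>)
    then have graph: "curve_alpha y z ` I = graph_on (range Y) ?f"
      unfolding trace by (intro range_eq_graph_on strict_mono_imp_inj_on)
    have cont: "isCont Y v" for v
      by (rule DERIV_isCont[OF Y])
    have minimum: "single_minimum (range Y) ?f" if "a > 0"
      using that by (intro single_minimum_reparametrized[OF mono cont] profile_height_less) auto
    have maximum: "single_maximum (range Y) ?f" if "a < 0"
      unfolding single_maximum_iff_minimum_uminus using that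
      by (intro single_minimum_reparametrized[OF mono cont, of "\<lambda>v. - profile_height a z0 v"])
         (auto intro: profile_height_less)
    have strip: "\<exists>y1 y2 f. y1 < y2 \<and>
          curve_alpha y z ` I = graph_on {y1<..<y2} f \<and>
          (m < - 2 \<longrightarrow> single_minimum {y1<..<y2} f) \<and>
          (m > - 1 \<longrightarrow> single_maximum {y1<..<y2} f) \<and>
          asymptotic_to_vertical_line {y1<..<y2} f y1 \<and>
          asymptotic_to_vertical_line {y1<..<y2} f y2" if "m > - 1 \<or> m < - 2"
    proof -
      have "a < 0 \<or> a > 1" using that by (auto simp: a_def)
      define y1 y2 where "y1 = Inf (range Y)" and "y2 = Sup (range Y)"
      have range: "range Y = {y1<..<y2}"
        unfolding y1_def y2_def
        using range_bounded_strict_mono[OF mono cont]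
          profile_width_bounded[OF Y \<open>a < 0 \<or> a > 1\<close>] by blast
      then have "y1 < y2"
        by (metis UNIV_not_empty greaterThanLessThan_empty_iff image_is_empty not_le)
      then show ?thesis
        using graph minimum maximum
          asymptotic_reparametrized[OF mono range profile_height_unbounded[OF \<open>a \<noteq> 0\<close>]]
        unfolding range
        by (intro exI[of _ y1] exI[of _ y2] exI[of _ ?f]) (auto simp: a_def)
    qed
    have entire: "\<exists>f. curve_alpha y z ` I = graph_on UNIV f \<and> single_minimum UNIV f"
      if "- 2 < m" "m < - 1"
    proof -
      have "surj Y"
        using that by (intro profile_width_surjective[OF Y]) (auto simp: a_def)
      then show ?thesis
        using graph minimum that by (auto simp: a_def)
    qed
    have log_cosh: "equal_up_to_integration_constants (curve_alpha y z ` I)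
        (graph_on UNIV (\<lambda>u. ln (cosh u)))" if "m = - 2"
    proof -
      have "a = 1" using that by (simp add: a_def)
      then show ?thesis
        using profile_is_log_cosh[of Y z0] Y trace by simp
    qed
    show ?thesis
      using umbilical minimal strip entire log_cosh by blast
  qed
qed

end
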